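(* Let $(V,V^+)$ be an ordered $*$-vector space with order unit $e$, and let $\|\cdot\|$ denote the order seminorm on $V_h$. Define the maximal order seminorm $\|\cdot\|_M : V\to[0,\infty)$ by $$\|v\|_M := \inf \left\{ \sum_{i=1}^n |\lambda_i| \, \|v_i\| \ : \ n\in\mathbb{N},\ v = \sum_{i=1}^n \lambda_i v_i \text{ with } v_i \in V_h \text{ and } \lambda_i \in \mathbb{C} \right\}.$$ The following are true: (1) $\|\cdot\|_M$ is a $*$-seminorm on the complex $*$-vector space $V$; (2) $\|v\|_M=\|v\|$ for all $v \in V_h$; and (3) if $|||\cdot|||$ is any other $*$-seminorm on the complex vector space $V$ such that $|||v||| = \|v\|_M$ for every $v \in V_h$, then $|||v||| \leq \|v\|_M$ for every $v \in V$.
   Context: A $*$-vector space is a complex vector space $V$ with a conjugate-linear involution $*:V\to V$; $V_h:=\{x\in V: x^*=x\}$. An ordered $*$-vector space $(V,V^+)$ is a $*$-vector space $V$ with a nonempty subset $V^+\subseteq V_h$ closed under addition and under multiplication by scalars in $[0,\infty)$, such that $V^+\cap -V^+=\{0\}$. For $v,w\in V_h$ write $v\ge w$ if $v-w\in V^+$. An element $e\in V_h$ is an order unit if for every $x\in V_h$ there is a real $r>0$ with $re\ge x$. The order seminorm on $V_h$ (determined by $e$) is $\|v\|:=\inf\{r\in\mathbb{R}: re+v\ge0\text{ and }re-v\ge0\}$. A $*$-seminorm on $V$ is a (complex) seminorm $|||\cdot|||$ on $V$ with $|||v^*|||=|||v|||$ for all $v\in V$. *)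

theory Defs
  imports Complex_Main
begin

locale star_vector_space = vector_space scale
  for scale :: "complex \<Rightarrow> 'v::ab_group_add \<Rightarrow> 'v" +
  fixes star :: "'v \<Rightarrow> 'v"
  assumes star_add: "star (x + y) = star x + star y"
    and star_scale: "star (scale a x) = scale (cnj a) (star x)"
    and star_star: "star (star x) = x"

definition hermitian :: "('v \<Rightarrow> 'v) \<Rightarrow> 'v set" where
  "hermitian star = {x. star x = x}"

locale ordered_star_vector_space = star_vector_space scale star
  for scale :: "complex \<Rightarrow> 'v::ab_group_add \<Rightarrow> 'v" and star :: "'v \<Rightarrow> 'v" +
  fixes pos :: "'v set"
  assumes pos_nonempty: "pos \<noteq> {}"
    and pos_hermitian: "pos \<subseteq> hermitian star"
    and pos_add: "x \<in> pos \<Longrightarrow> y \<in> pos \<Longrightarrow> x + y \<in> pos"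
    and pos_scale: "x \<in> pos \<Longrightarrow> 0 \<le> r \<Longrightarrow> scale (complex_of_real r) x \<in> pos"
    and pos_proper: "pos \<inter> uminus ` pos = {0}"

definition order_ge :: "'v::ab_group_add set \<Rightarrow> 'v \<Rightarrow> 'v \<Rightarrow> bool" where
  "order_ge pos v w \<longleftrightarrow> v - w \<in> pos"

definition order_unit ::
    "(complex \<Rightarrow> 'v::ab_group_add \<Rightarrow> 'v) \<Rightarrow> ('v \<Rightarrow> 'v) \<Rightarrow> 'v set \<Rightarrow> 'v \<Rightarrow> bool" where
  "order_unit scale star pos e \<longleftrightarrow>
     e \<in> hermitian star \<and>
     (\<forall>x\<in>hermitian star. \<exists>r::real. r > 0 \<and> order_ge pos (scale (complex_of_real r) e) x)"

text \<open>An order unit \<open>e\<close> vanishes only if the whole space is zero (lemma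
  \<open>order_unit_eq_0_iff\<close> below). The infimum is then taken over all of \<open>\<real>\<close> and is not a real
  number; the order seminorm of the zero space is 0 by convention. The function is meaningful
  only on \<open>hermitian star\<close>.\<close>

definition order_seminorm ::
    "(complex \<Rightarrow> 'v::ab_group_add \<Rightarrow> 'v) \<Rightarrow> 'v set \<Rightarrow> 'v \<Rightarrow> 'v \<Rightarrow> real" where
  "order_seminorm scale pos e v =
     (if e = 0 then 0
      else Inf {r::real. order_ge pos (scale (complex_of_real r) e + v) 0 \<and>
                         order_ge pos (scale (complex_of_real r) e - v) 0})"

definition star_seminorm ::
    "(complex \<Rightarrow> 'v::ab_group_add \<Rightarrow> 'v) \<Rightarrow> ('v \<Rightarrow> 'v) \<Rightarrow> ('v \<Rightarrow> real) \<Rightarrow> bool" where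
  "star_seminorm scale star p \<longleftrightarrow>
     (\<forall>v. 0 \<le> p v) \<and>
     (\<forall>a v. p (scale a v) = cmod a * p v) \<and>
     (\<forall>v w. p (v + w) \<le> p v + p w) \<and>
     (\<forall>v. p (star v) = p v)"

definition max_order_seminorm ::
    "(complex \<Rightarrow> 'v::ab_group_add \<Rightarrow> 'v) \<Rightarrow> ('v \<Rightarrow> 'v) \<Rightarrow> 'v set \<Rightarrow> 'v \<Rightarrow> 'v \<Rightarrow> real" where
  "max_order_seminorm scale star pos e v =
     Inf {(\<Sum>i=1..n. cmod (l i) * order_seminorm scale pos e (x i)) | (n::nat) l x.
            v = (\<Sum>i=1..n. scale (l i) (x i)) \<and> (\<forall>i\<in>{1..n}. x i \<in> hermitian star)}"

lemma (in ordered_star_vector_space) order_unit_eq_0_iff: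
  assumes "order_unit scale star pos e"
  shows "e = 0 \<longleftrightarrow> (UNIV :: 'v set) = {0}"
proof
  assume e: "e = 0"
  have herm0: "x = 0" if x: "x \<in> hermitian star" for x :: 'v
  proof -
    have "star 0 = 0" using star_add[of 0 0] by simp
    then have "star (- x) = - x"
      using x star_add[of x "- x"] by (simp add: hermitian_def eq_neg_iff_add_eq_0 add.commute)
    then have "- x \<in> pos" "x \<in> pos"
      using assms x e by (fastforce simp: order_unit_def order_ge_def hermitian_def)+
    then show "x = 0" using pos_proper by (metis IntI imageI minus_minus singletonD)
  qed
  have "v = 0" for v :: 'v
  proof -
    have "v + star v = 0"
      by (intro herm0) (simp add: hermitian_def star_add star_star add.commute)
    then have sv: "star v = - v"
      by (simp add: add_eq_0_iff)
    have "scale \<i> v + star (scale \<i> v) = 0"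
      by (intro herm0) (simp only: hermitian_def star_add star_star add.commute mem_Collect_eq)
    moreover have "star (scale \<i> v) = scale \<i> v"
      by (simp add: star_scale sv scale_minus_left scale_minus_right)
    ultimately have "scale \<i> v + scale \<i> v = 0"
      by simp
    then have "scale (2 * \<i>) v = 0"
      by (metis mult_2 scale_left_distrib)
    then show "v = 0" by simp
  qed
  then show "(UNIV :: 'v set) = {0}" by auto
next
  assume "(UNIV :: 'v set) = {0}"
  then show "e = 0" by blast
qed

end

theory Submission
  imports Defs
begin

text \<open>
  The order seminorm \<open>N\<close> is a real seminorm on the hermitian elements, because the elements
  \<open>r e + v\<close> and \<open>r e - v\<close> are positive for every \<open>r > N v\<close>. The maximal order seminorm \<open>M v\<close> is
  the infimum of the costs \<open>\<Sum> \<bar>l\<^sub>i\<bar> N x\<^sub>i\<close> of the decompositions \<open>v = \<Sum> l\<^sub>i x\<^sub>i\<close> into hermitian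
  elements. Decompositions exist, since every vector is a hermitian element plus \<open>\<i>\<close> times
  another; they can be concatenated, multiplied by a scalar and conjugated, with the
  corresponding effect on costs, and this makes \<open>M\<close> a \<open>*\<close>-seminorm.

  The other two claims follow from one maximality principle (\<open>le_max_seminorm\<close>): a subadditive
  function \<open>q\<close> with \<open>q 0 \<le> 0\<close> and \<open>q (l x) \<le> \<bar>l\<bar> N x\<close> for hermitian \<open>x\<close> satisfies \<open>q \<le> M\<close>.
  A \<open>*\<close>-seminorm that agrees with \<open>N\<close> on the hermitian elements is such a \<open>q\<close>. So is
  \<open>v \<mapsto> N (Re v)\<close>, where \<open>Re v = (v + v\<^sup>*) / 2\<close>, because \<open>Re (l x) = (Re l) x\<close> for hermitian \<open>x\<close>;
  this gives \<open>N v \<le> M v\<close> for hermitian \<open>v\<close>, and the decomposition \<open>v = 1 v\<close> gives the converse.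
\<close>

section \<open>Hermitian elements\<close>

context star_vector_space
begin

lemma star_zero: "star 0 = 0"
  using star_add[of 0 0] by simp

lemma star_minus: "star (- x) = - star x"
  using star_add[of x "- x"] by (simp add: star_zero eq_neg_iff_add_eq_0 add.commute)

lemma star_sum: "star (\<Sum>i\<in>A. f i) = (\<Sum>i\<in>A. star (f i))"
  by (induction A rule: infinite_finite_induct) (simp_all add: star_zero star_add)

lemma hermitian_minus: "x \<in> hermitian star \<Longrightarrow> - x \<in> hermitian star"
  by (simp add: hermitian_def star_minus)

lemma hermitian_zero: "0 \<in> hermitian star"
  by (simp add: hermitian_def star_zero)

lemma hermitian_scale_real:
  "x \<in> hermitian star \<Longrightarrow> scale (complex_of_real t) x \<in> hermitian star"
  by (simp add: hermitian_def star_scale)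

text \<open>The hermitian part \<open>(v + v\<^sup>*) / 2\<close> of a vector.\<close>

definition real_part :: "'v \<Rightarrow> 'v" where
  "real_part v = scale (complex_of_real (1/2)) (v + star v)"

lemma real_part_hermitian: "real_part v \<in> hermitian star"
  unfolding real_part_def
  by (intro hermitian_scale_real) (simp add: hermitian_def star_add star_star add.commute)

lemma real_part_add: "real_part (v + w) = real_part v + real_part w"
  by (simp add: real_part_def star_add scale_right_distrib algebra_simps)

lemma real_part_scale:
  assumes "x \<in> hermitian star"
  shows "real_part (scale l x) = scale (complex_of_real (Re l)) x"
proof -
  have "real_part (scale l x) = scale (complex_of_real (1/2) * (l + cnj l)) x"
    using assms by (simp add: real_part_def hermitian_def star_scale flip: scale_left_distrib)
  also have "complex_of_real (1/2) * (l + cnj l) = complex_of_real (Re l)"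
    by (simp add: complex_eq_iff)
  finally show ?thesis .
qed

lemma real_part_id: "v \<in> hermitian star \<Longrightarrow> real_part v = v"
  using real_part_scale[of v 1] by simp

lemma cartesian_decomposition:
  obtains x y where "x \<in> hermitian star" "y \<in> hermitian star" "v = x + scale \<i> y"
proof
  let ?y = "real_part (scale (- \<i>) v)"
  have "scale \<i> ?y = scale (1/2) (v - star v)"
    by (simp add: real_part_def star_scale star_minus scale_right_distrib
        scale_right_diff_distrib)
  then have "real_part v + scale \<i> ?y = scale (1/2 + 1/2) v"
    by (simp only: scale_left_distrib)
      (simp add: real_part_def scale_right_distrib scale_right_diff_distrib)
  then show "v = real_part v + scale \<i> ?y" by simp
qed (rule real_part_hermitian)+

end

section \<open>The order seminorm on hermitian elements\<close>

text \<open>An ordered \<open>*\<close>-vector space with a chosen order unit \<open>e\<close>. The order seminorm is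
  abbreviated to \<open>N\<close> and the maximal order seminorm to \<open>M\<close>.\<close>

locale order_unit_space = ordered_star_vector_space scale star pos
  for scale :: "complex \<Rightarrow> 'v::ab_group_add \<Rightarrow> 'v" and star and pos +
  fixes e :: 'v
  assumes unit: "order_unit scale star pos e"
begin

abbreviation N :: "'v \<Rightarrow> real" where
  "N \<equiv> order_seminorm scale pos e"

abbreviation M :: "'v \<Rightarrow> real" where
  "M \<equiv> max_order_seminorm scale star pos e"

lemma zero_pos: "0 \<in> pos"
  using pos_proper by blast

lemma unit_dominates:
  assumes "x \<in> hermitian star"
  obtains r :: real where "r > 0" "scale (complex_of_real r) e - x \<in> pos"
  using unit assms unfolding order_unit_def order_ge_def by blast

lemma unit_pos: "e \<in> pos"
proof -
  obtain r :: real where r: "r > 0" "scale (complex_of_real r) e \<in> pos"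
    using unit_dominates[OF hermitian_zero] by auto
  have "scale (complex_of_real (1/r)) (scale (complex_of_real r) e) \<in> pos"
    by (intro pos_scale[OF r(2)]) (use r in simp)
  moreover have "complex_of_real (1/r) * complex_of_real r = 1"
    using r by simp
  ultimately show ?thesis by (metis scale_scale scale_one)
qed

lemma unit_multiple_mono:
  assumes "scale (complex_of_real r) e + v \<in> pos" "r \<le> s"
  shows "scale (complex_of_real s) e + v \<in> pos"
proof -
  have "(scale (complex_of_real r) e + v) + scale (complex_of_real (s - r)) e \<in> pos"
    by (intro pos_add assms pos_scale unit_pos) (use assms in auto)
  then show ?thesis by (simp add: scale_left_diff_distrib algebra_simps)
qed

lemma bound_nonneg:
  assumes "e \<noteq> 0"
    and "scale (complex_of_real r) e + v \<in> pos" "scale (complex_of_real r) e - v \<in> pos"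
  shows "0 \<le> r"
proof (rule ccontr)
  assume "\<not> 0 \<le> r"
  then have r: "r < 0" by simp
  have "(scale (complex_of_real r) e + v) + (scale (complex_of_real r) e - v) \<in> pos"
    by (intro pos_add assms)
  then have "scale (complex_of_real r + complex_of_real r) e \<in> pos"
    by (simp only: scale_left_distrib) (simp add: algebra_simps)
  \<comment> \<open>The sum is \<open>2 r e\<close> with \<open>r < 0\<close>, so a positive multiple of it is \<open>- e\<close>.\<close>
  then have "scale (complex_of_real (- 1 / (2 * r)))
      (scale (complex_of_real r + complex_of_real r) e) \<in> pos"
    using r by (intro pos_scale) (auto simp: field_simps)
  moreover have "complex_of_real (- 1 / (2 * r)) * (complex_of_real r + complex_of_real r) = - 1"
    using r by (simp add: complex_eq_iff field_simps)
  ultimately have "- e \<in> pos"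
    by (metis scale_scale scale_minus_left scale_one)
  then have "e \<in> pos \<inter> uminus ` pos"
    using unit_pos by (metis IntI imageI minus_minus)
  with pos_proper assms(1) show False by auto
qed

lemma bound_exists:
  assumes "v \<in> hermitian star"
  shows "\<exists>r. scale (complex_of_real r) e + v \<in> pos \<and> scale (complex_of_real r) e - v \<in> pos"
proof -
  obtain r where r: "scale (complex_of_real r) e - v \<in> pos"
    using unit_dominates[OF assms] by auto
  obtain s where s: "scale (complex_of_real s) e + v \<in> pos"
    using unit_dominates[OF hermitian_minus[OF assms]] by auto
  from unit_multiple_mono[OF s, of "max r s"] unit_multiple_mono[of r "- v" "max r s"] r
  show ?thesis by auto
qed

text \<open>The hypothesis \<open>0 \<le> r\<close> matters only in the zero space.\<close>

lemma order_seminorm_le: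
  assumes "0 \<le> r"
    and "scale (complex_of_real r) e + v \<in> pos" "scale (complex_of_real r) e - v \<in> pos"
  shows "N v \<le> r"
proof (cases "e = 0")
  case False
  then show ?thesis
    unfolding order_seminorm_def order_ge_def
    using assms by (auto intro!: cInf_lower bdd_belowI[of _ 0] intro: bound_nonneg)
qed (use assms in \<open>simp add: order_seminorm_def\<close>)

lemma order_seminorm_nonneg:
  assumes "v \<in> hermitian star"
  shows "0 \<le> N v"
proof (cases "e = 0")
  case False
  then show ?thesis
    unfolding order_seminorm_def order_ge_def
    using bound_exists[OF assms] by (auto intro!: cInf_greatest intro: bound_nonneg)
qed (simp add: order_seminorm_def)

lemma order_seminorm_less_pos:
  assumes "v \<in> hermitian star" "N v < r"
  shows "scale (complex_of_real r) e + v \<in> pos" "scale (complex_of_real r) e - v \<in> pos"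
proof -
  have "scale (complex_of_real r) e + v \<in> pos \<and> scale (complex_of_real r) e - v \<in> pos"
  proof (cases "e = 0")
    case True
    then have "v = 0" using order_unit_eq_0_iff[OF unit] by blast
    with True zero_pos show ?thesis by simp
  next
    case False
    let ?B = "{r. scale (complex_of_real r) e + v \<in> pos \<and> scale (complex_of_real r) e - v \<in> pos}"
    have "?B \<noteq> {}"
      using bound_exists[OF assms(1)] by blast
    moreover have "Inf ?B < r"
      using assms False by (simp add: order_seminorm_def order_ge_def)
    ultimately have "\<exists>s\<in>?B. s < r"
      by (rule cInf_lessD)
    then obtain s where s: "s \<in> ?B" "s < r" ..
    with unit_multiple_mono[of s v r] unit_multiple_mono[of s "- v" r] show ?thesis by simp
  qed
  then show "scale (complex_of_real r) e + v \<in> pos" "scale (complex_of_real r) e - v \<in> pos"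
    by auto
qed

lemma order_seminorm_add:
  assumes v: "v \<in> hermitian star" and w: "w \<in> hermitian star"
  shows "N (v + w) \<le> N v + N w"
proof (rule field_le_epsilon)
  fix d :: real
  assume d: "0 < d"
  let ?r = "N v + d/2" and ?s = "N w + d/2"
  have plus: "(scale (complex_of_real ?r) e + v) + (scale (complex_of_real ?s) e + w) \<in> pos"
    and minus: "(scale (complex_of_real ?r) e - v) + (scale (complex_of_real ?s) e - w) \<in> pos"
    by (intro pos_add order_seminorm_less_pos v w; use d in simp)+
  have sum: "scale (complex_of_real (?r + ?s)) e
      = scale (complex_of_real ?r) e + scale (complex_of_real ?s) e"
    by (simp only: of_real_add scale_left_distrib)
  have "N (v + w) \<le> ?r + ?s"
  proof (rule order_seminorm_le)
    show "0 \<le> ?r + ?s"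
      using order_seminorm_nonneg[OF v] order_seminorm_nonneg[OF w] d by simp
    show "scale (complex_of_real (?r + ?s)) e + (v + w) \<in> pos"
      using plus unfolding sum by (simp only: ac_simps)
    show "scale (complex_of_real (?r + ?s)) e - (v + w) \<in> pos"
      using minus unfolding sum by (simp only: add_diff_add)
  qed
  then show "N (v + w) \<le> N v + N w + d" by simp
qed

lemma order_seminorm_scale_real_le:
  assumes v: "v \<in> hermitian star"
  shows "N (scale (complex_of_real t) v) \<le> \<bar>t\<bar> * N v"
proof -
  have *: "N (scale (complex_of_real t) v) \<le> \<bar>t\<bar> * r" if r: "N v < r" for r
  proof (rule order_seminorm_le)
    show "0 \<le> \<bar>t\<bar> * r" using r order_seminorm_nonneg[OF v] by simp
    have plus: "scale (complex_of_real \<bar>t\<bar>) (scale (complex_of_real r) e + v) \<in> pos"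
      and minus: "scale (complex_of_real \<bar>t\<bar>) (scale (complex_of_real r) e - v) \<in> pos"
      by (intro pos_scale order_seminorm_less_pos v r; simp)+
    show "scale (complex_of_real (\<bar>t\<bar> * r)) e + scale (complex_of_real t) v \<in> pos"
      using plus minus
      by (cases "0 \<le> t") (simp_all add: scale_right_distrib scale_right_diff_distrib)
    show "scale (complex_of_real (\<bar>t\<bar> * r)) e - scale (complex_of_real t) v \<in> pos"
      using plus minus
      by (cases "0 \<le> t") (simp_all add: scale_right_distrib scale_right_diff_distrib)
  qed
  show ?thesis
  proof (cases "t = 0")
    case True
    then show ?thesis using *[of "N v + 1"] by simp
  next
    case False
    have "N (scale (complex_of_real t) v) / \<bar>t\<bar> \<le> N v"
    proof (rule dense_ge)
      fix r
      assume "N v < r"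
      from *[OF this] show "N (scale (complex_of_real t) v) / \<bar>t\<bar> \<le> r"
        using False by (simp add: pos_divide_le_eq mult.commute)
    qed
    then show ?thesis using False by (simp add: pos_divide_le_eq mult.commute)
  qed
qed

section \<open>Decompositions into hermitian elements\<close>

text \<open>The relation that \<open>c\<close> is the cost \<open>\<Sum> \<bar>l\<^sub>i\<bar> N x\<^sub>i\<close> of some decomposition
  \<open>v = \<Sum> l\<^sub>i x\<^sub>i\<close> into hermitian elements. The empty decomposition of \<open>0\<close>, of cost \<open>0\<close>, counts.\<close>

definition decomposition_cost :: "'v \<Rightarrow> real \<Rightarrow> bool" where
  "decomposition_cost v c \<longleftrightarrow>
     (\<exists>(n::nat) l x. c = (\<Sum>i=1..n. cmod (l i) * N (x i)) \<and>
        v = (\<Sum>i=1..n. scale (l i) (x i)) \<and> (\<forall>i\<in>{1..n}. x i \<in> hermitian star))"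

lemma max_seminorm_eq: "M v = Inf {c. decomposition_cost v c}"
  by (simp add: max_order_seminorm_def decomposition_cost_def)

lemma decomposition_costE:
  assumes "decomposition_cost v c"
  obtains n :: nat and l x where "c = (\<Sum>i=1..n. cmod (l i) * N (x i))"
    "v = (\<Sum>i=1..n. scale (l i) (x i))" "\<And>i. i \<in> {1..n} \<Longrightarrow> x i \<in> hermitian star"
  using assms unfolding decomposition_cost_def by blast

lemma decomposition_costI:
  fixes n :: nat
  assumes "c = (\<Sum>i=1..n. cmod (l i) * N (x i))"
    "v = (\<Sum>i=1..n. scale (l i) (x i))" "\<And>i. i \<in> {1..n} \<Longrightarrow> x i \<in> hermitian star"
  shows "decomposition_cost v c"
  using assms unfolding decomposition_cost_def by blast

lemma decomposition_cost_nonneg: "decomposition_cost v c \<Longrightarrow> 0 \<le> c"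
  by (erule decomposition_costE) (auto intro!: sum_nonneg mult_nonneg_nonneg order_seminorm_nonneg)

lemma decomposition_cost_zero: "decomposition_cost 0 0"
  by (rule decomposition_costI[where n = 0]) auto

lemma decomposition_cost_single:
  "x \<in> hermitian star \<Longrightarrow> decomposition_cost (scale l x) (cmod l * N x)"
  by (rule decomposition_costI[where n = 1 and l = "\<lambda>_. l" and x = "\<lambda>_. x"]) auto

lemma sum_split: "(\<Sum>i=1..n+m. h i) = (\<Sum>i=1..n. h i) + (\<Sum>i=1..m. h (i + n))"
  for h :: "nat \<Rightarrow> 'a::comm_monoid_add"
  using sum.ub_add_nat[of 1 n h m] sum.shift_bounds_cl_nat_ivl[of h 1 n m]
  by (simp add: add.commute)

lemma decomposition_cost_add:
  assumes "decomposition_cost v c" "decomposition_cost w d"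
  shows "decomposition_cost (v + w) (c + d)"
proof -
  obtain n :: nat and l x where v: "c = (\<Sum>i=1..n. cmod (l i) * N (x i))"
    "v = (\<Sum>i=1..n. scale (l i) (x i))" "\<And>i. i \<in> {1..n} \<Longrightarrow> x i \<in> hermitian star"
    using assms(1) by (rule decomposition_costE) blast
  obtain m :: nat and k y where w: "d = (\<Sum>i=1..m. cmod (k i) * N (y i))"
    "w = (\<Sum>i=1..m. scale (k i) (y i))" "\<And>i. i \<in> {1..m} \<Longrightarrow> y i \<in> hermitian star"
    using assms(2) by (rule decomposition_costE) blast
  let ?l = "\<lambda>i. if i \<le> n then l i else k (i - n)"
  let ?x = "\<lambda>i. if i \<le> n then x i else y (i - n)"
  show ?thesis
  proof (rule decomposition_costI)
    show "c + d = (\<Sum>i=1..n+m. cmod (?l i) * N (?x i))"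
      unfolding sum_split v(1) w(1) by simp
    show "v + w = (\<Sum>i=1..n+m. scale (?l i) (?x i))"
      unfolding sum_split v(2) w(2) by simp
    show "?x i \<in> hermitian star" if "i \<in> {1..n+m}" for i
      using that v(3) w(3) by (cases "i \<le> n") (simp_all add: le_diff_conv)
  qed
qed

lemma decomposition_cost_scale:
  assumes "decomposition_cost v c"
  shows "decomposition_cost (scale a v) (cmod a * c)"
  using assms
proof (rule decomposition_costE)
  fix n :: nat and l x
  assume "c = (\<Sum>i=1..n. cmod (l i) * N (x i))" "v = (\<Sum>i=1..n. scale (l i) (x i))"
    "\<And>i. i \<in> {1..n} \<Longrightarrow> x i \<in> hermitian star"
  then show ?thesis
    by (intro decomposition_costI[where n = n and l = "\<lambda>i. a * l i" and x = x])
      (auto simp: scale_sum_right sum_distrib_left norm_mult mult.assoc)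
qed

lemma decomposition_cost_star:
  assumes "decomposition_cost v c"
  shows "decomposition_cost (star v) c"
  using assms
proof (rule decomposition_costE)
  fix n :: nat and l x
  assume "c = (\<Sum>i=1..n. cmod (l i) * N (x i))" "v = (\<Sum>i=1..n. scale (l i) (x i))"
    "\<And>i. i \<in> {1..n} \<Longrightarrow> x i \<in> hermitian star"
  then show ?thesis
    by (intro decomposition_costI[where n = n and l = "\<lambda>i. cnj (l i)" and x = x])
      (auto simp: star_sum star_scale hermitian_def)
qed

lemma decomposition_cost_exists: "\<exists>c. decomposition_cost v c"
proof -
  obtain x y where xy: "x \<in> hermitian star" "y \<in> hermitian star" "v = x + scale \<i> y"
    using cartesian_decomposition .
  then show ?thesis
    using decomposition_cost_add[OF decomposition_cost_single[of x 1]
        decomposition_cost_single[of y \<i>]] by auto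
qed

section \<open>The maximal order seminorm\<close>

lemma max_seminorm_le: "decomposition_cost v c \<Longrightarrow> M v \<le> c"
  unfolding max_seminorm_eq
  by (auto intro!: cInf_lower bdd_belowI[of _ 0] decomposition_cost_nonneg)

lemma max_seminorm_greatest: "(\<And>c. decomposition_cost v c \<Longrightarrow> b \<le> c) \<Longrightarrow> b \<le> M v"
  unfolding max_seminorm_eq using decomposition_cost_exists
  by (auto intro!: cInf_greatest)

lemma max_seminorm_nonneg: "0 \<le> M v"
  by (intro max_seminorm_greatest decomposition_cost_nonneg)

lemma max_seminorm_zero: "M 0 = 0"
  using max_seminorm_le[OF decomposition_cost_zero] max_seminorm_nonneg[of 0] by simp

lemma max_seminorm_add: "M (v + w) \<le> M v + M w"
proof -
  have "M (v + w) - M v \<le> d" if d: "decomposition_cost w d" for d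
  proof -
    have "M (v + w) - d \<le> M v"
    proof (rule max_seminorm_greatest)
      fix c
      assume "decomposition_cost v c"
      from max_seminorm_le[OF decomposition_cost_add[OF this d]]
      show "M (v + w) - d \<le> c" by simp
    qed
    then show ?thesis by simp
  qed
  then have "M (v + w) - M v \<le> M w" by (rule max_seminorm_greatest)
  then show ?thesis by simp
qed

lemma max_seminorm_scale: "M (scale a v) = cmod a * M v"
proof (cases "a = 0")
  case True
  then show ?thesis by (simp add: max_seminorm_zero)
next
  case False
  have le: "M (scale b w) \<le> cmod b * M w" if b: "b \<noteq> 0" for b w
  proof -
    have "M (scale b w) / cmod b \<le> M w"
    proof (rule max_seminorm_greatest)
      fix c
      assume "decomposition_cost w c"
      from max_seminorm_le[OF decomposition_cost_scale[OF this, of b]]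
      show "M (scale b w) / cmod b \<le> c" using b by (simp add: field_simps)
    qed
    then show ?thesis using b by (simp add: field_simps)
  qed
  show ?thesis
  proof (rule antisym)
    show "M (scale a v) \<le> cmod a * M v" using False by (rule le)
    have "M (scale (inverse a) (scale a v)) \<le> cmod (inverse a) * M (scale a v)"
      using False by (intro le) simp
    then show "cmod a * M v \<le> M (scale a v)"
      using False by (simp add: norm_divide field_simps)
  qed
qed

lemma max_seminorm_star: "M (star v) = M v"
proof -
  have le: "M (star w) \<le> M w" for w
    by (intro max_seminorm_greatest max_seminorm_le decomposition_cost_star)
  show ?thesis using le[of v] le[of "star v"] by (simp add: star_star)
qed

theorem star_seminorm_max_seminorm: "star_seminorm scale star M"
  by (simp add: star_seminorm_def max_seminorm_nonneg max_seminorm_scale max_seminorm_add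
      max_seminorm_star)

text \<open>The maximality principle. It requires homogeneity of \<open>q\<close> only as an inequality, and only on
  multiples of hermitian elements, so that it applies to \<open>v \<mapsto> N (real_part v)\<close>, which in
  general is not a complex seminorm.\<close>

lemma le_max_seminorm:
  assumes zero: "q 0 \<le> 0"
    and add: "\<And>v w. q (v + w) \<le> q v + q w"
    and scale: "\<And>l x. x \<in> hermitian star \<Longrightarrow> q (scale l x) \<le> cmod l * N x"
  shows "q v \<le> M v"
proof (rule max_seminorm_greatest)
  fix c
  assume "decomposition_cost v c"
  then show "q v \<le> c"
  proof (rule decomposition_costE)
    fix n :: nat and l x
    assume c: "c = (\<Sum>i=1..n. cmod (l i) * N (x i))" and v: "v = (\<Sum>i=1..n. scale (l i) (x i))"
      and x: "\<And>i. i \<in> {1..n} \<Longrightarrow> x i \<in> hermitian star"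
    have "q (\<Sum>i\<in>A. f i) \<le> (\<Sum>i\<in>A. q (f i))" if "finite A" for A and f :: "nat \<Rightarrow> 'v"
      using that
    proof (induction A rule: finite_induct)
      case (insert a A)
      then show ?case using add[of "f a" "\<Sum>i\<in>A. f i"] by simp
    qed (simp add: zero)
    then have "q v \<le> (\<Sum>i=1..n. q (scale (l i) (x i)))" by (simp add: v)
    also have "\<dots> \<le> c" unfolding c by (intro sum_mono scale x)
    finally show "q v \<le> c" .
  qed
qed

theorem max_seminorm_eq_order_seminorm:
  assumes v: "v \<in> hermitian star"
  shows "M v = N v"
proof (rule antisym)
  show "M v \<le> N v"
    using max_seminorm_le[OF decomposition_cost_single[OF v, of 1]] by simp
  have "N (real_part v) \<le> M v"
  proof (rule le_max_seminorm[where q = "\<lambda>v. N (real_part v)"])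
    show "N (real_part 0) \<le> 0"
      using order_seminorm_scale_real_le[OF hermitian_zero, of 0]
      by (simp add: real_part_id hermitian_zero)
  next
    fix v w
    show "N (real_part (v + w)) \<le> N (real_part v) + N (real_part w)"
      by (simp add: real_part_add order_seminorm_add real_part_hermitian)
  next
    fix l x
    assume x: "x \<in> hermitian star"
    have "N (real_part (scale l x)) \<le> \<bar>Re l\<bar> * N x"
      using order_seminorm_scale_real_le[OF x] by (simp add: real_part_scale[OF x])
    also have "\<dots> \<le> cmod l * N x"
      by (intro mult_right_mono abs_Re_le_cmod order_seminorm_nonneg x)
    finally show "N (real_part (scale l x)) \<le> cmod l * N x" .
  qed
  then show "N v \<le> M v" by (simp add: real_part_id v)
qed

theorem max_seminorm_maximal:
  assumes p: "star_seminorm scale star p"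
    and eq: "\<And>v. v \<in> hermitian star \<Longrightarrow> p v = M v"
  shows "p v \<le> M v"
proof (rule le_max_seminorm)
  show "p 0 \<le> 0"
    using eq[OF hermitian_zero] by (simp add: max_seminorm_zero)
qed (use p in \<open>auto simp: star_seminorm_def eq max_seminorm_eq_order_seminorm\<close>)

end

theorem theorem4p7:
  fixes scale :: "complex \<Rightarrow> 'v::ab_group_add \<Rightarrow> 'v"
    and star :: "'v \<Rightarrow> 'v"
    and pos :: "'v set"
    and e :: 'v
  assumes "ordered_star_vector_space scale star pos"
    and "order_unit scale star pos e"
  shows "star_seminorm scale star (max_order_seminorm scale star pos e) \<and>
    (\<forall>v\<in>hermitian star. max_order_seminorm scale star pos e v = order_seminorm scale pos e v) \<and>
    (\<forall>p. star_seminorm scale star p \<and>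
         (\<forall>v\<in>hermitian star. p v = max_order_seminorm scale star pos e v) \<longrightarrow>
         (\<forall>v. p v \<le> max_order_seminorm scale star pos e v))"
proof -
  interpret order_unit_space scale star pos e
    using assms by (simp add: order_unit_space_def order_unit_space_axioms_def)
  show ?thesis
    using star_seminorm_max_seminorm max_seminorm_eq_order_seminorm max_seminorm_maximal by blast
qed

end
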